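(* Let $D$ be a 2-connected rooted digraph with root $r$, and assume that $D$ has $l$ nice vertices. Then $D$ has an outbranching rooted at $r$ with at least $\frac{l}{24}$ leaves.
   Context: A rooted digraph is a loopless digraph $D$ with a distinguished vertex $r$ (the root) such that: there is no arc $(u,r)$ for any $u\in V(D)$; there is no arc $(x,y)$ with $x\neq r$ and $y$ an outneighbour of $r$; and $r$ has outdegree at least 2. A cut of $D$ is a set $S\subseteq V(D)\setminus\{r\}$ such that some vertex $z\notin S$ is not the endpoint of any directed path starting at $r$ in $D-S$; $D$ is 2-connected if it has no cut of size at most 1. An arc $(u,v)$ is simple if it does not belong to a 2-circuit, i.e. $(v,u)$ is not an arc of $D$. A vertex $v$ is nice if it has a simple in-arc. An outbranching of $D$ is a spanning subdigraph which is a directed tree rooted at $r$ with all arcs directed away from $r$; its leaves are the vertices of outdegree 0 in it. *)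

theory Defs
  imports Complex_Main
begin

text \<open>A digraph is given by a vertex set V and an arc set A of ordered pairs.\<close>

definition digraph :: "'a set \<Rightarrow> ('a \<times> 'a) set \<Rightarrow> bool" where
  "digraph V A \<longleftrightarrow> finite V \<and> A \<subseteq> V \<times> V \<and> (\<forall>v. (v, v) \<notin> A)"

definition rooted_digraph :: "'a set \<Rightarrow> ('a \<times> 'a) set \<Rightarrow> 'a \<Rightarrow> bool" where
  "rooted_digraph V A r \<longleftrightarrow> digraph V A \<and> r \<in> V
     \<and> (\<forall>u. (u, r) \<notin> A)
     \<and> (\<forall>x y. (x, y) \<in> A \<and> x \<noteq> r \<longrightarrow> (r, y) \<notin> A)
     \<and> card {y. (r, y) \<in> A} \<ge> 2"

text \<open>Vertices reachable from r by a directed path in D - S (arcs with both ends outside S).\<close>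
definition reach_avoiding :: "('a \<times> 'a) set \<Rightarrow> 'a \<Rightarrow> 'a set \<Rightarrow> 'a set" where
  "reach_avoiding A r S = {z. (r, z) \<in> (A \<inter> ((- S) \<times> (- S)))\<^sup>*}"

definition is_cut :: "'a set \<Rightarrow> ('a \<times> 'a) set \<Rightarrow> 'a \<Rightarrow> 'a set \<Rightarrow> bool" where
  "is_cut V A r S \<longleftrightarrow> S \<subseteq> V - {r} \<and> (\<exists>z \<in> V - S. z \<notin> reach_avoiding A r S)"

definition two_connected :: "'a set \<Rightarrow> ('a \<times> 'a) set \<Rightarrow> 'a \<Rightarrow> bool" where
  "two_connected V A r \<longleftrightarrow> (\<forall>S. is_cut V A r S \<longrightarrow> card S \<ge> 2)"

definition simple_arc :: "('a \<times> 'a) set \<Rightarrow> 'a \<times> 'a \<Rightarrow> bool" where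
  "simple_arc A e \<longleftrightarrow> e \<in> A \<and> (snd e, fst e) \<notin> A"

definition nice_vertices :: "'a set \<Rightarrow> ('a \<times> 'a) set \<Rightarrow> 'a set" where
  "nice_vertices V A = {v \<in> V. \<exists>u. simple_arc A (u, v)}"

text \<open>An outbranching: spanning subdigraph (same vertex set, arc subset) that is a directed
  tree rooted at r with arcs directed away from r: r has in-degree 0, every other vertex has
  in-degree exactly 1, and every vertex is reachable from r.\<close>
definition outbranching :: "'a set \<Rightarrow> ('a \<times> 'a) set \<Rightarrow> 'a \<Rightarrow> ('a \<times> 'a) set \<Rightarrow> bool" where
  "outbranching V A r B \<longleftrightarrow> B \<subseteq> A
     \<and> (\<forall>u. (u, r) \<notin> B)
     \<and> (\<forall>v \<in> V - {r}. \<exists>!u. (u, v) \<in> B)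
     \<and> (\<forall>v \<in> V. (r, v) \<in> B\<^sup>*)"

definition leaves :: "'a set \<Rightarrow> ('a \<times> 'a) set \<Rightarrow> 'a set" where
  "leaves V B = {v \<in> V. \<forall>w. (v, w) \<notin> B}"

end

theory Submission
  imports Defs
begin

text \<open>The vertices other than r are numbered so that each one, except the out-neighbours of r, has an
  in-neighbour before it and one after it. Keeping one of each gives a forward and a backward spanning
  tree. A forward arc is transverse if it closes no circuit with the backward tree, and vice versa. A simple
  in-arc of a nice vertex is transverse itself or forces a transverse out-arc, so there are at least half as
  many transverse arcs as nice vertices other than the out-neighbours of r, which each contribute to the
  leaf count because they share their parent. At least a quarter of the transverse arcs can be added to the tree of
  the other direction without creating a circuit; in the resulting acyclic digraph every choice of
  in-arcs is an outbranching, and a vertex cover argument finds one in which few vertices are parents.\<close>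

section \<open>Numberings of 2-connected digraphs\<close>

text \<open>A set of sources replaces the root: in the theorem \<open>R\<close> holds the
  out-neighbours of the deleted root, and the recursion in \<open>ex_flanked_order\<close> also uses
  the pair \<open>x\<close>, \<open>y\<close> as sources.\<close>

inductive_set reach_from :: "('a \<times> 'a) set \<Rightarrow> 'a set \<Rightarrow> 'a set \<Rightarrow> 'a set"
  for E R X where
  base: "s \<in> R \<Longrightarrow> s \<notin> X \<Longrightarrow> s \<in> reach_from E R X"
| step: "u \<in> reach_from E R X \<Longrightarrow> (u, v) \<in> E \<Longrightarrow> v \<notin> X \<Longrightarrow> v \<in> reach_from E R X"

lemma reach_from_not_in: "v \<in> reach_from E R X \<Longrightarrow> v \<notin> X"
  by (induction rule: reach_from.induct) auto

lemma reach_from_crossing: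
  assumes "v \<in> reach_from E R X" "v \<notin> R"
  shows "\<exists>x y. x \<in> R \<and> y \<notin> R \<and> (x, y) \<in> E"
  using assms by (induction rule: reach_from.induct) auto

text \<open>The local condition of an st-numbering, phrased for lists so that an interval can be
  spliced into an order.\<close>

definition flanked :: "('a \<times> 'a) set \<Rightarrow> 'a list \<Rightarrow> 'a \<Rightarrow> bool" where
  "flanked E xs v \<longleftrightarrow>
     (\<exists>ps qs. xs = ps @ v # qs \<and> (\<exists>a\<in>set ps. (a, v) \<in> E) \<and> (\<exists>b\<in>set qs. (b, v) \<in> E))"

lemma flanked_rev: "flanked E (rev xs) v \<longleftrightarrow> flanked E xs v"
proof -
  have *: "flanked E ys v \<Longrightarrow> flanked E (rev ys) v" for ys
    unfolding flanked_def
  proof (elim exE conjE bexE)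
    fix ps qs a b
    assume "ys = ps @ v # qs" "a \<in> set ps" "(a, v) \<in> E" "b \<in> set qs" "(b, v) \<in> E"
    then show "\<exists>ps qs. rev ys = ps @ v # qs \<and> (\<exists>a\<in>set ps. (a, v) \<in> E) \<and> (\<exists>b\<in>set qs. (b, v) \<in> E)"
      by (intro exI[of _ "rev qs"] exI[of _ "rev ps"]) auto
  qed
  show ?thesis using *[of xs] *[of "rev xs"] by auto
qed

lemma flanked_not_hd: "distinct (h # t) \<Longrightarrow> \<not> flanked E (h # t) h"
  unfolding flanked_def by (auto simp: Cons_eq_append_conv)

lemma flanked_not_last: "distinct (t @ [h]) \<Longrightarrow> \<not> flanked E (t @ [h]) h"
  using flanked_not_hd[of h "rev t" E] flanked_rev[of E "t @ [h]" h] by auto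

lemma flanked_extend:
  assumes "flanked E' xs v" "E' \<subseteq> E"
  shows "flanked E (as @ xs @ bs) v"
proof -
  obtain ps qs where "xs = ps @ v # qs" "\<exists>a\<in>set ps. (a, v) \<in> E'" "\<exists>b\<in>set qs. (b, v) \<in> E'"
    using assms(1) unfolding flanked_def by auto
  then show ?thesis using assms(2) unfolding flanked_def
    by (intro exI[of _ "as @ ps"] exI[of _ "qs @ bs"]) auto
qed

text \<open>Here \<open>E'\<close> stands for a digraph in which \<open>ms\<close> was contracted
  into \<open>x\<close>, so an arc of \<open>E'\<close> leaving \<open>x\<close> may really leave
  \<open>ms\<close>. As \<open>ms\<close> is inserted directly behind \<open>x\<close>, its members
  lie on the same side of \<open>v\<close> as \<open>x\<close> does.\<close>

lemma flanked_expand: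
  assumes fl: "flanked E' (as @ x # bs) v" and d: "distinct (as @ x # bs)" and vx: "v \<noteq> x"
    and arcs: "\<And>a. (a, v) \<in> E' \<Longrightarrow> (a, v) \<in> E \<or> a = x \<and> (\<exists>u\<in>set ms. (u, v) \<in> E)"
  shows "flanked E (as @ x # ms @ bs) v"
proof -
  obtain ps qs a b where e: "as @ x # bs = ps @ v # qs"
    and a: "a \<in> set ps" "(a, v) \<in> E'" and b: "b \<in> set qs" "(b, v) \<in> E'"
    using fl unfolding flanked_def by auto
  have "(\<exists>us. as = ps @ v # us \<and> qs = us @ x # bs) \<or> (\<exists>us. bs = us @ v # qs \<and> ps = as @ x # us)"
    using e vx by (auto simp: append_eq_append_conv2 Cons_eq_append_conv append_eq_Cons_conv)
  then show ?thesis
  proof (elim disjE exE conjE)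
    fix us assume us: "as = ps @ v # us" "qs = us @ x # bs"
    have "(a, v) \<in> E" using a arcs d us by auto
    moreover have "\<exists>c\<in>set (us @ x # ms @ bs). (c, v) \<in> E" using b arcs us by fastforce
    ultimately show ?thesis unfolding flanked_def using us a
      by (intro exI[of _ ps] exI[of _ "us @ x # ms @ bs"]) auto
  next
    fix us assume us: "bs = us @ v # qs" "ps = as @ x # us"
    have "(b, v) \<in> E" using b arcs d us by auto
    moreover have "\<exists>c\<in>set (as @ x # ms @ us). (c, v) \<in> E" using a arcs us by fastforce
    ultimately show ?thesis unfolding flanked_def using us b
      by (intro exI[of _ "as @ x # ms @ us"] exI[of _ qs]) auto
  qed
qed

text \<open>An end of a duplicate-free list has nothing on one side and cannot be flanked; so the
  ends are \<open>x\<close> and \<open>y\<close>, and reversal puts them in the wanted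
  order.\<close>

lemma flanked_list_ends:
  assumes d: "distinct ys" and s: "set ys = insert x (insert y Z)" and xy: "x \<noteq> y"
    and fl: "\<And>v. v \<in> Z \<Longrightarrow> flanked E ys v"
  obtains zs where "distinct (x # zs @ [y])" "insert x (insert y (set zs)) = insert x (insert y Z)"
    "\<And>v. v \<in> Z \<Longrightarrow> flanked E (x # zs @ [y]) v"
proof -
  have "ys \<noteq> []" using s by auto
  then obtain h t where ht: "ys = h # t" by (cases ys) auto
  have "t \<noteq> []" using ht s xy by auto
  then obtain zs k where zk: "t = zs @ [k]" by (cases t rule: rev_cases) auto
  have "h \<notin> Z" using fl[of h] flanked_not_hd[of h t E] d ht by auto
  moreover have "k \<notin> Z" using fl flanked_not_last[of "h # zs" k E] d ht zk by auto
  moreover have "h \<noteq> k" using d ht zk by auto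
  moreover have "h \<in> insert x (insert y Z)" "k \<in> insert x (insert y Z)"
    unfolding s[symmetric] using ht zk by auto
  ultimately have "h = x \<and> k = y \<or> h = y \<and> k = x" by blast
  then show thesis
  proof
    assume "h = x \<and> k = y"
    then show thesis using that[of zs] d s fl ht zk by simp
  next
    assume hk: "h = y \<and> k = x"
    have "rev ys = x # rev zs @ [y]" using hk ht zk by simp
    then have "\<And>v. v \<in> Z \<Longrightarrow> flanked E (x # rev zs @ [y]) v"
      using fl flanked_rev by metis
    moreover have "distinct (x # rev zs @ [y])" "insert x (insert y (set (rev zs))) = insert x (insert y Z)"
      using d s ht zk hk by auto
    ultimately show thesis using that by blast
  qed
qed

text \<open>Pick an arc (x, y) leaving R and let Z be the set separated from R by x and y. Contracting Z and
  y into x preserves 2-connectivity, because whatever survives is reached without x, y and Z. The digraph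
  induced on Z, x, y with sources x and y is 2-connected as well, so Z is numbered between x and y.
  This interval replaces x, with y on the side of an in-neighbour of y outside it.\<close>
lemma ex_flanked_order:
  assumes "finite W" "R \<subseteq> W" "R \<noteq> {}" "E \<subseteq> W \<times> W"
    and "\<And>v w. w \<in> W \<Longrightarrow> v \<in> W \<Longrightarrow> v \<noteq> w \<Longrightarrow> v \<in> reach_from E R {w}"
  shows "\<exists>xs. distinct xs \<and> set xs = W \<and> (\<forall>v\<in>W - R. flanked E xs v)"
  using assms
proof (induction "card W" arbitrary: W R E rule: less_induct)
  case less
  note fin = less.prems(1) and RW = less.prems(2) and Rne = less.prems(3)
    and EW = less.prems(4) and conn = less.prems(5)
  show ?case
  proof (cases "R = W")
    case True
    then show ?thesis using finite_distinct_list[OF fin] by auto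
  next
    case False
    obtain v0 s0 where "v0 \<in> W" "v0 \<notin> R" "s0 \<in> R" using RW Rne False by auto
    then have "v0 \<in> reach_from E R {s0}" using conn RW by auto
    then obtain x y where xR: "x \<in> R" and yR: "y \<notin> R" and xyE: "(x, y) \<in> E"
      using reach_from_crossing \<open>v0 \<notin> R\<close> by meson
    have xW: "x \<in> W" and yW: "y \<in> W" and xy: "x \<noteq> y" using xyE EW xR yR by auto
    define Z where "Z = W - {x, y} - reach_from E R {x, y}"
    have RZ: "R \<inter> Z = {}" using yR unfolding Z_def by (auto intro: reach_from.base)
    have Zin: "u \<in> insert x (insert y Z)" if "(u, v) \<in> E" "v \<in> Z" for u v
    proof (rule ccontr)
      assume "u \<notin> insert x (insert y Z)"
      then have "u \<in> reach_from E R {x, y}" using that(1) EW unfolding Z_def by auto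
      then have "v \<in> reach_from E R {x, y}" using that unfolding Z_def by (auto intro: reach_from.step)
      then show False using that unfolding Z_def by auto
    qed

    \<comment> \<open>On a path that avoids \<open>x\<close>, everything before the first visit to
      \<open>y\<close> avoids both. For \<open>t = y\<close> this yields \<open>z\<close>, an
      in-neighbour of \<open>y\<close> outside \<open>Z\<close>.\<close>
    have "t \<in> reach_from E R {x, y} \<or> (\<exists>z\<in>reach_from E R {x, y}. (z, y) \<in> E)"
      if "t \<in> reach_from E R {x}" for t
      using that
    proof (induction rule: reach_from.induct)
      case (base s)
      then have "s \<in> reach_from E R {x, y}" using yR by (auto intro: reach_from.base)
      then show ?case by blast
    next
      case (step u v)
      then show ?case
        by (metis insert_iff reach_from.step singletonD)
    qed
    moreover have "y \<in> reach_from E R {x}" using conn xW yW xy by auto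
    ultimately obtain z where zr: "z \<in> reach_from E R {x, y}" and zyE: "(z, y) \<in> E"
      using reach_from_not_in by fastforce
    have zW: "z \<in> W" and zZ: "z \<notin> Z" and zx: "z \<noteq> x" and zy: "z \<noteq> y"
      using zyE EW zr reach_from_not_in[OF zr] unfolding Z_def by auto

    define W2 where "W2 = insert x (insert y Z)"
    define E2 where "E2 = E \<inter> (W2 \<times> W2)"
    have "card W2 < card W"
      using xW yW zW zZ zx zy unfolding W2_def Z_def by (intro psubset_card_mono[OF fin]) auto
    moreover have "finite W2" using fin unfolding W2_def Z_def by auto
    moreover have "v \<in> reach_from E2 {x, y} {w}" if w: "w \<in> W2" and v: "v \<in> W2" "v \<noteq> w" for v w
    proof -
      have "v \<in> reach_from E R {w}" using conn w v xW yW unfolding W2_def Z_def by auto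
      \<comment> \<open>The path may leave \<open>W2\<close>, so the invariant speaks only of its
        vertices in \<open>W2\<close>. It re-enters at \<open>x\<close> or \<open>y\<close>, both
        sources, since \<open>Zin\<close> admits arcs into \<open>Z\<close> only from
        \<open>W2\<close>.\<close>
      then have "v \<in> W2 \<longrightarrow> v \<in> reach_from E2 {x, y} {w}"
      proof (induction rule: reach_from.induct)
        case (base s)
        then show ?case using RZ yR unfolding W2_def by (auto intro: reach_from.base)
      next
        case (step u v)
        show ?case
        proof
          assume v: "v \<in> W2"
          show "v \<in> reach_from E2 {x, y} {w}"
          proof (cases "v \<in> Z")
            case True
            then have "u \<in> W2" using Zin step unfolding W2_def by auto
            then show ?thesis using step v unfolding E2_def by (auto intro: reach_from.step)
          next
            case False
            then show ?thesis using step v unfolding W2_def by (auto intro: reach_from.base)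
          qed
        qed
      qed
      then show ?thesis using v by auto
    qed
    ultimately have "\<exists>ys. distinct ys \<and> set ys = W2 \<and> (\<forall>v\<in>W2 - {x, y}. flanked E2 ys v)"
      by (intro less.hyps) (auto simp: W2_def E2_def)
    then obtain ys where ys: "distinct ys" "set ys = insert x (insert y Z)"
      "\<And>v. v \<in> Z \<Longrightarrow> flanked E2 ys v"
      unfolding W2_def Z_def by blast
    obtain zs where zs: "distinct (x # zs @ [y])"
        "insert x (insert y (set zs)) = insert x (insert y Z)"
        "\<And>v. v \<in> Z \<Longrightarrow> flanked E2 (x # zs @ [y]) v"
      using flanked_list_ends[OF ys(1,2) xy ys(3)] by metis
    have setzs: "set zs = Z" using zs(1,2) unfolding Z_def by auto

    define W1 where "W1 = W - insert y Z"
    define c where "c u = (if u \<in> insert y Z then x else u)" for u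
    define E1 where "E1 = {(c u, v) | u v. (u, v) \<in> E \<and> v \<notin> insert y Z}"
    have xW1: "x \<in> W1" using xW xy unfolding W1_def Z_def by auto
    have "card W1 < card W"
      using yW unfolding W1_def by (intro psubset_card_mono[OF fin]) auto
    moreover have "finite W1" using fin unfolding W1_def by auto
    moreover have "R \<subseteq> W1" using RW RZ yR unfolding W1_def by auto
    moreover have "E1 \<subseteq> W1 \<times> W1"
      using EW xW1 unfolding E1_def c_def W1_def by (auto split: if_splits)
    moreover have "v \<in> reach_from E1 R {w}" if w: "w \<in> W1" and v: "v \<in> W1" "v \<noteq> w" for v w
    \<comment> \<open>If \<open>w\<close> is not \<open>x\<close>, paths are mapped by
      \<open>c\<close>. If \<open>x\<close> is deleted, the other vertices of \<open>W1\<close> are,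
      by the definition of \<open>Z\<close>, reachable without \<open>x\<close> and
      \<open>y\<close>, and such a path never meets \<open>Z\<close>.\<close>
    proof (cases "w = x")
      case False
      have "v \<in> reach_from E R {w}" using conn w v unfolding W1_def by auto
      then have "c v \<in> reach_from E1 R {w}"
      proof (induction rule: reach_from.induct)
        case (base s)
        then show ?case using xR False unfolding c_def by (auto intro: reach_from.base)
      next
        case (step u v)
        show ?case
        proof (cases "v \<in> insert y Z")
          case True
          then show ?thesis using xR False unfolding c_def by (auto intro: reach_from.base)
        next
          case v: False
          then have "(c u, v) \<in> E1" using step unfolding E1_def by auto
          moreover have "c v = v" using v unfolding c_def by auto
          ultimately show ?thesis using step by (auto intro: reach_from.step)
        qed
      qed
      then show ?thesis using v unfolding c_def W1_def by auto
    next
      case True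
      have *: "u \<notin> insert y Z" if "u \<in> reach_from E R {x, y}" for u
        using that reach_from_not_in[OF that] unfolding Z_def by auto
      have "v \<in> reach_from E R {x, y}" using v True unfolding W1_def Z_def by auto
      then have "v \<in> reach_from E1 R {x}"
      proof (induction rule: reach_from.induct)
        case (base s)
        then show ?case by (auto intro: reach_from.base)
      next
        case (step u v)
        have "v \<in> reach_from E R {x, y}" using step by (auto intro: reach_from.step)
        then have "v \<notin> insert y Z" "c u = u" using * step(1) unfolding c_def by auto
        then have "(u, v) \<in> E1" using step(2) unfolding E1_def by force
        then show ?case using step by (auto intro: reach_from.step)
      qed
      then show ?thesis using True by simp
    qed
    ultimately have "\<exists>xs. distinct xs \<and> set xs = W1 \<and> (\<forall>v\<in>W1 - R. flanked E1 xs v)"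
      using Rne by (intro less.hyps)
    then obtain xs where xs: "distinct xs" "set xs = W1" "\<And>v. v \<in> W1 - R \<Longrightarrow> flanked E1 xs v"
      by blast
    obtain as0 bs0 where ab0: "xs = as0 @ x # bs0" using xW1 xs(2) by (metis split_list)
    have "z \<in> W1" using zW zZ zy unfolding W1_def by auto
    then have "z \<in> set as0 \<or> z \<in> set bs0" using xs(2) ab0 zx by auto
    \<comment> \<open>A reversal, if needed, puts \<open>z\<close> behind \<open>x\<close>; then
      \<open>y\<close>, at the end of the inserted interval, has \<open>x\<close> before it and
      \<open>z\<close> after it.\<close>
    then have "\<exists>as bs. (xs = as @ x # bs \<or> rev xs = as @ x # bs) \<and> z \<in> set bs"
      using ab0 by (metis append_Cons append_Nil append_assoc rev.simps(2) rev_append set_rev)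
    then obtain as bs where ab: "xs = as @ x # bs \<or> rev xs = as @ x # bs" and zbs: "z \<in> set bs"
      by blast
    have d: "distinct (as @ x # bs)" and s: "set (as @ x # bs) = W1"
      using ab xs by (metis distinct_rev, metis set_rev)
    have fl: "flanked E1 (as @ x # bs) v" if "v \<in> W1 - R" for v
      using ab xs(3)[OF that] flanked_rev by metis

    let ?ms = "zs @ [y]"
    have "distinct (as @ x # ?ms @ bs)"
      using d s zs(1) setzs unfolding W1_def by auto
    moreover have "set (as @ x # ?ms @ bs) = W"
      using s setzs yW unfolding W1_def Z_def by auto
    moreover have "flanked E (as @ x # ?ms @ bs) v" if v: "v \<in> W - R" for v
    proof -
      consider "v \<in> Z" | "v = y" | "v \<in> W1" using v unfolding W1_def by auto
      then show ?thesis
      proof cases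
        case 1
        then have "flanked E (as @ (x # ?ms) @ bs) v"
          by (intro flanked_extend[OF zs(3)]) (auto simp: E2_def)
        then show ?thesis by simp
      next
        case 2
        show ?thesis unfolding flanked_def
          using 2 xyE zyE zbs by (intro exI[of _ "as @ x # zs"] exI[of _ bs]) auto
      next
        case 3
        show ?thesis
        proof (rule flanked_expand[OF fl d])
          show "v \<in> W1 - R" "v \<noteq> x" using 3 v xR by auto
          show "(a, v) \<in> E \<or> a = x \<and> (\<exists>u\<in>set ?ms. (u, v) \<in> E)" if "(a, v) \<in> E1" for a
            using that setzs unfolding E1_def c_def by (auto split: if_splits)
        qed
      qed
    qed
    ultimately show ?thesis by blast
  qed
qed

text \<open>\<open>\<sigma>\<close> is the position in the list, taken as an integer so that
  negation reverses the order.\<close>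

lemma ex_flanked_numbering:
  assumes "finite W" "R \<subseteq> W" "R \<noteq> {}" "E \<subseteq> W \<times> W"
    and "\<And>v w. w \<in> W \<Longrightarrow> v \<in> W \<Longrightarrow> v \<noteq> w \<Longrightarrow> v \<in> reach_from E R {w}"
  obtains \<sigma> :: "'a \<Rightarrow> int" where "inj_on \<sigma> W"
    "\<And>v. v \<in> W - R \<Longrightarrow> \<exists>a b. (a, v) \<in> E \<and> (b, v) \<in> E \<and> \<sigma> a < \<sigma> v \<and> \<sigma> v < \<sigma> b"
proof -
  obtain xs where d: "distinct xs" and s: "set xs = W" and fl: "\<forall>v\<in>W - R. flanked E xs v"
    using ex_flanked_order[OF assms] by auto
  define \<sigma> where "\<sigma> v = int (THE i. i < length xs \<and> xs ! i = v)" for v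
  have \<sigma>: "\<sigma> (xs ! i) = int i" if "i < length xs" for i
    unfolding \<sigma>_def using that d by (auto simp: nth_eq_iff_index_eq)
  have "inj_on \<sigma> W"
    unfolding s[symmetric] by (rule inj_onI) (auto simp: in_set_conv_nth \<sigma>)
  moreover have "\<exists>a b. (a, v) \<in> E \<and> (b, v) \<in> E \<and> \<sigma> a < \<sigma> v \<and> \<sigma> v < \<sigma> b" if v: "v \<in> W - R" for v
  proof -
    obtain ps qs a b where e: "xs = ps @ v # qs" and ab: "a \<in> set ps" "(a, v) \<in> E" "b \<in> set qs" "(b, v) \<in> E"
      using bspec[OF fl v] unfolding flanked_def by blast
    obtain i j where i: "i < length ps" "a = ps ! i" and j: "j < length qs" "b = qs ! j"
      using ab by (auto simp: in_set_conv_nth)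
    have "\<sigma> a = int i" "\<sigma> v = int (length ps)" "\<sigma> b = int (length ps + Suc j)"
      using \<sigma>[of i] \<sigma>[of "length ps"] \<sigma>[of "length ps + Suc j"] i j e by (auto simp: nth_append)
    then show ?thesis using ab i by (intro exI[of _ a] exI[of _ b]) auto
  qed
  ultimately show thesis using that by blast
qed

section \<open>Leaves of acyclic digraphs\<close>

text \<open>View \<open>L\<close> as edges with ends \<open>g v\<close> and \<open>h v\<close>. A
  vertex on two edges goes into the cover: this costs 3 on the left and removes at least 1 + 2 on
  the right. Once there is none, the edges form a matching, so
  \<open>2 * card L \<le> card U\<close> and one end of each edge suffices.\<close>

lemma ex_small_vertex_cover:
  assumes "finite U" "finite L"
    and "\<And>v. v \<in> L \<Longrightarrow> g v \<in> U \<and> h v \<in> U \<and> g v \<noteq> h v"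
  shows "\<exists>C\<subseteq>U. 3 * card C \<le> card U + card L \<and> (\<forall>v\<in>L. g v \<in> C \<or> h v \<in> C)"
  using assms
proof (induction "card U" arbitrary: U L rule: less_induct)
  case less
  note fU = less.prems(1) and fL = less.prems(2) and gh = less.prems(3)
  let ?I = "\<lambda>u. {v \<in> L. g v = u \<or> h v = u}"
  show ?case
  proof (cases "\<exists>u\<in>U. card (?I u) \<ge> 2")
    case True
    then obtain u where u: "u \<in> U" "card (?I u) \<ge> 2" by auto
    have "card (U - {u}) < card U" using u(1) fU by (intro card_Diff1_less)
    then have "\<exists>C\<subseteq>U - {u}. 3 * card C \<le> card (U - {u}) + card (L - ?I u) \<and>
        (\<forall>v\<in>L - ?I u. g v \<in> C \<or> h v \<in> C)"
      using fU fL gh by (intro less.hyps) auto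
    then obtain C where C: "C \<subseteq> U - {u}" "3 * card C \<le> card (U - {u}) + card (L - ?I u)"
      "\<forall>v\<in>L - ?I u. g v \<in> C \<or> h v \<in> C" by auto
    have "card (?I u) + card (L - ?I u) = card (?I u \<union> (L - ?I u))"
      using fL by (intro card_Un_disjoint[symmetric]) auto
    moreover have "?I u \<union> (L - ?I u) = L" by auto
    moreover have "card (U - {u}) + 1 = card U" using u(1) fU by (metis Suc_eq_plus1 card.remove)
    moreover have "card (insert u C) \<le> card C + 1" by (intro card_insert_le_m1) auto
    ultimately have "3 * card (insert u C) \<le> card U + card L" using C(2) u(2) by simp
    then show ?thesis using C u by (intro exI[of _ "insert u C"]) auto
  next
    case False
    have inc: "v = w" if "v \<in> L" "w \<in> L" "u \<in> {g v, h v}" "u \<in> {g w, h w}" for u v w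
    proof (rule ccontr)
      assume "v \<noteq> w"
      then have "card {v, w} = 2" by simp
      moreover have "card {v, w} \<le> card (?I u)" using fL that by (intro card_mono) auto
      moreover have "u \<in> U" using gh that by auto
      ultimately show False using False by auto
    qed
    have "inj_on g L"
    proof (rule inj_onI)
      show "v = w" if "v \<in> L" "w \<in> L" "g v = g w" for v w
        using inc[of v w "g v"] that by simp
    qed
    moreover have "inj_on h L"
    proof (rule inj_onI)
      show "v = w" if "v \<in> L" "w \<in> L" "h v = h w" for v w
        using inc[of v w "h v"] that by simp
    qed
    ultimately have "card (g ` L) = card L" "card (h ` L) = card L"
      by (simp_all add: card_image)
    moreover have "g ` L \<inter> h ` L = {}"
    proof -
      have False if "v \<in> L" "w \<in> L" "g v = h w" for v w
        using inc[of v w "h w"] gh[of w] that by simp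
      then show ?thesis by blast
    qed
    then have "card (g ` L \<union> h ` L) = card (g ` L) + card (h ` L)"
      using fL by (intro card_Un_disjoint) auto
    moreover have "card (g ` L \<union> h ` L) \<le> card U"
      using gh fU by (intro card_mono) auto
    ultimately have "3 * card (g ` L) \<le> card U + card L" by linarith
    then show ?thesis using gh by (intro exI[of _ "g ` L"]) auto
  qed
qed

text \<open>\<open>P\<close> collects the parents of the vertices without a choice. The remaining
  vertices \<open>U\<close> number at least \<open>card L + card R\<close>; a cover \<open>C\<close>
  of the pairs that miss \<open>P\<close> supplies the other parents, and \<open>U - C\<close> stays
  childless.\<close>

lemma ex_parents_many_leaves:
  assumes fW: "finite W" and rW: "r \<notin> W" and LW: "L \<subseteq> W" and RW: "R \<subseteq> W - L"
    and gR: "\<And>v. v \<in> R \<Longrightarrow> g v = r"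
    and gh: "\<And>v. v \<in> L \<Longrightarrow> g v \<in> insert r W \<and> h v \<in> insert r W \<and> g v \<noteq> h v"
  shows "\<exists>q. (\<forall>v\<in>W. q v = g v \<or> v \<in> L \<and> q v = h v) \<and>
    card L + 2 * card R \<le> 3 * card (insert r W - q ` W)"
proof -
  have fin: "finite L" "finite R" using fW LW RW finite_subset by blast+
  define P where "P = g ` (W - L)"
  \<comment> \<open>All of \<open>R\<close> shares the parent \<open>r\<close>, which costs one; the
    root, as an extra vertex of \<open>insert r W\<close>, compensates for it below.\<close>
  have "P \<subseteq> insert r (g ` (W - L - R))" unfolding P_def using gR by auto
  then have "card P \<le> card (insert r (g ` (W - L - R)))" using fW by (intro card_mono) auto
  also have "\<dots> \<le> Suc (card (g ` (W - L - R)))" by (intro card_insert_le_m1) auto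
  also have "\<dots> \<le> Suc (card (W - L - R))" using fW by (simp add: card_image_le)
  finally have P: "card P \<le> Suc (card (W - L - R))" .
  have "card (W - L - R) + card R = card (W - L)"
    using card_Diff_subset[OF fin(2) RW] card_mono[OF _ RW] fW by simp
  moreover have "card (W - L) + card L = card W"
    using card_Diff_subset[OF fin(1) LW] card_mono[OF fW LW] by simp
  moreover define U where "U = insert r W - P"
  have "Suc (card W) \<le> card U + card P"
  proof -
    have "Suc (card W) = card (insert r W)" using fW rW by simp
    also have "\<dots> \<le> card (U \<union> P)" using fW unfolding U_def P_def by (intro card_mono) auto
    also have "\<dots> \<le> card U + card P" by (rule card_Un_le)
    finally show ?thesis .
  qed
  ultimately have U: "card L + card R \<le> card U" using P by linarith

  define L' where "L' = {v \<in> L. g v \<notin> P \<and> h v \<notin> P}"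
  have fU: "finite U" "finite L'" using fin fW unfolding U_def L'_def by auto
  obtain C where C: "C \<subseteq> U" "3 * card C \<le> card U + card L'" "\<forall>v\<in>L'. g v \<in> C \<or> h v \<in> C"
    using ex_small_vertex_cover[OF fU, of g h] gh unfolding U_def L'_def by auto
  have "card L' \<le> card L" using fin unfolding L'_def by (intro card_mono) auto
  moreover have "card (U - C) + card C = card U"
    using card_Diff_subset[of C U] card_mono[OF fU(1) C(1)] C(1) finite_subset[OF C(1) fU(1)] by simp
  ultimately have count: "card L + 2 * card R \<le> 3 * card (U - C)" using C(2) U by linarith

  define q where "q v = (if v \<in> L \<and> g v \<notin> P \<union> C then h v else g v)" for v
  have "q ` W \<subseteq> P \<union> C" using C(3) unfolding q_def L'_def P_def by auto
  then have "card (U - C) \<le> card (insert r W - q ` W)"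
    using fW unfolding U_def by (intro card_mono) auto
  then show ?thesis using count unfolding q_def by (intro exI[of _ q]) (auto simp: q_def)
qed

text \<open>Arcs inside a strict order form no circuit, so on a finite set the walk from any vertex
  to its successive parents stops, and it can stop only at \<open>r\<close>.\<close>

lemma outbranching_of_parents:
  assumes fW: "finite W" and rW: "r \<notin> W" and S: "trans S" "irrefl S"
    and q: "\<And>v. v \<in> W \<Longrightarrow> q v \<in> insert r W \<and> (q v, v) \<in> A \<and> (q v, v) \<in> S"
  shows "outbranching (insert r W) A r {(q v, v) | v. v \<in> W}" (is "outbranching _ _ _ ?B")
    and "leaves (insert r W) {(q v, v) | v. v \<in> W} = insert r W - q ` W"
proof -
  have "?B = (\<lambda>v. (q v, v)) ` W" by auto
  then have fB: "finite ?B" using fW by simp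
  have "?B \<subseteq> S" using q by auto
  then have "?B\<^sup>+ \<subseteq> S" using trancl_mono_subset[of ?B S] trancl_id[OF S(1)] by simp
  then have "wf ?B" using fB S(2) by (intro finite_acyclic_wf) (auto simp: acyclic_def irrefl_def)
  then have "v \<in> insert r W \<longrightarrow> (r, v) \<in> ?B\<^sup>*" for v
  proof (induction v rule: wf_induct_rule)
    case (less v)
    show ?case
    proof
      assume "v \<in> insert r W"
      then consider "v = r" | "v \<in> W" by auto
      then show "(r, v) \<in> ?B\<^sup>*"
      proof cases
        case 2
        then have "(q v, v) \<in> ?B" by auto
        moreover have "(r, q v) \<in> ?B\<^sup>*" using less[OF \<open>(q v, v) \<in> ?B\<close>] q[OF 2] by blast
        ultimately show ?thesis by (rule rtrancl_into_rtrancl[rotated])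
      qed simp
    qed
  qed
  then show "outbranching (insert r W) A r ?B"
    unfolding outbranching_def
  proof (intro conjI ballI allI)
    show "\<exists>!u. (u, v) \<in> ?B" if "v \<in> insert r W - {r}" for v
      using that by (intro ex1I[of _ "q v"]) auto
  qed (use q rW in auto)
  show "leaves (insert r W) ?B = insert r W - q ` W"
    unfolding leaves_def by auto
qed

section \<open>Transverse arcs\<close>

definition parent_arcs :: "'a set \<Rightarrow> ('a \<Rightarrow> 'a) \<Rightarrow> ('a \<times> 'a) set" where
  "parent_arcs W g = {(g v, v) | v. v \<in> W}"

text \<open>A transverse arc (f v, v) is recorded by its head v.\<close>
definition transverse :: "'a set \<Rightarrow> 'a set \<Rightarrow> ('a \<Rightarrow> 'a) \<Rightarrow> ('a \<Rightarrow> 'a) \<Rightarrow> 'a set" where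
  "transverse W R f b = {v \<in> W - R. (v, f v) \<notin> (parent_arcs W b)\<^sup>+}"

text \<open>Two spanning trees given by parent functions: away from the root \<open>\<sigma>\<close>
  increases along \<open>f\<close> and decreases along \<open>b\<close>. Only arcs within
  \<open>W\<close> are compared, since \<open>\<sigma> r\<close> is left open.\<close>

locale opposite_trees =
  fixes W R :: "'a set" and r :: 'a and \<sigma> :: "'a \<Rightarrow> int" and f b :: "'a \<Rightarrow> 'a"
  assumes finite_W: "finite W" and root: "r \<notin> W" and R_sub: "R \<subseteq> W" and inj: "inj_on \<sigma> W"
    and on_R: "v \<in> R \<Longrightarrow> f v = r" "v \<in> R \<Longrightarrow> b v = r"
    and forward: "v \<in> W - R \<Longrightarrow> f v \<in> W" "v \<in> W - R \<Longrightarrow> \<sigma> (f v) < \<sigma> v"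
    and backward: "v \<in> W - R \<Longrightarrow> b v \<in> W" "v \<in> W - R \<Longrightarrow> \<sigma> v < \<sigma> (b v)"
begin

lemma swap: "opposite_trees W R r (\<lambda>v. - \<sigma> v) b f"
  using finite_W root R_sub inj on_R forward backward
  by unfold_locales (auto simp: inj_on_def)

lemma forward_descendant:
  assumes "(x, y) \<in> (parent_arcs W f)\<^sup>*" "x \<in> W"
  shows "y \<in> W \<and> \<sigma> x \<le> \<sigma> y"
  using assms
proof (induction rule: rtrancl_induct)
  case (step y z)
  then have "z \<in> W" "y = f z" "y \<in> W" unfolding parent_arcs_def by auto
  moreover have "z \<notin> R" using on_R root calculation by auto
  ultimately show ?case using step forward(2)[of z] by force
qed auto

text \<open>\<open>p v\<close> lists the numbers along the backward tree path from \<open>r\<close>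
  (excluded) to \<open>v\<close>. The recursion ends because a backward parent has fewer vertices
  numbered above it.\<close>

lemma ex_root_path:
  "\<exists>p. p r = [] \<and> (\<forall>v\<in>W. p v = p (b v) @ [\<sigma> v])"
proof -
  define m where "m v = card {u \<in> W. \<sigma> v < \<sigma> u}" for v
  have m: "m (b v) < m v" if "v \<in> W" "b v \<in> W" for v
  proof -
    have "v \<notin> R" using that on_R root by auto
    then show ?thesis unfolding m_def using that backward[of v] finite_W
      by (intro psubset_card_mono) auto
  qed
  \<comment> \<open>The inner test admits a recursive call only where the measure drops; it fails
    for a vertex of \<open>W\<close> exactly when its parent is \<open>r\<close>.\<close>
  define p where "p = wfrec (measure m)
    (\<lambda>p v. if v \<in> W then (if b v \<in> W then p (b v) else []) @ [\<sigma> v] else [])"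
  have p: "p v = (if v \<in> W then (if b v \<in> W then p (b v) else []) @ [\<sigma> v] else [])" for v
    unfolding p_def by (subst wfrec) (auto simp: cut_apply m)
  then have "p v = p (b v) @ [\<sigma> v]" if "v \<in> W" for v
    using p[of v] p[of "b v"] that by auto
  moreover have "p r = []" using p[of r] root by auto
  ultimately show ?thesis by blast
qed

text \<open>By injectivity of \<open>\<sigma>\<close> the last entry of a root path determines its
  vertex, and removing that entry passes to the parent; removing all of \<open>zs\<close> thus
  climbs from \<open>u\<close> to \<open>v\<close>.\<close>

lemma ancestor_of_prefix:
  assumes p: "p r = []" "\<And>v. v \<in> W \<Longrightarrow> p v = p (b v) @ [\<sigma> v]"
    and uv: "u \<in> W" "v \<in> W" "p u = p v @ zs"
  shows "(v, u) \<in> (parent_arcs W b)\<^sup>*"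
  using uv
proof (induction "length (p u)" arbitrary: u zs rule: less_induct)
  case less
  show ?case
  proof (cases zs rule: rev_cases)
    case Nil
    then have "\<sigma> u = \<sigma> v" using less p(2)[of u] p(2)[of v] by simp
    then show ?thesis using inj less by (auto dest: inj_onD)
  next
    case (snoc ys z)
    then have e: "p (b u) = p v @ ys" using less p(2)[of u] by simp
    then have "p (b u) \<noteq> []" using p(2)[of v] less by simp
    then have "u \<notin> R" using p(1) on_R by auto
    then have "b u \<in> W" using backward less by auto
    then have "(v, b u) \<in> (parent_arcs W b)\<^sup>*"
      using less.hyps[of "b u" ys] e p(2)[OF less.prems(1)] less.prems(2) by simp
    moreover have "(b u, u) \<in> parent_arcs W b" using less unfolding parent_arcs_def by auto
    ultimately show ?thesis by simp
  qed
qed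

text \<open>Ordering the backward tree lexicographically by root paths, once with the siblings increasing and
  once decreasing, makes each transverse forward arc increasing in one of the two orders.\<close>
lemma ex_outbranching_transverse:
  assumes A: "\<And>v. v \<in> W \<Longrightarrow> (f v, v) \<in> A \<and> (b v, v) \<in> A"
  shows "\<exists>B. outbranching (insert r W) A r B \<and>
    card (transverse W R f b) + 4 * card R \<le> 6 * card (leaves (insert r W) B)"
proof -
  let ?T = "transverse W R f b"
  obtain p where p: "p r = []" "\<And>v. v \<in> W \<Longrightarrow> p v = p (b v) @ [\<sigma> v]"
    using ex_root_path by blast
  define S where "S less = inv_image (lexord less) p" for less
  let ?up = "{(i, j). i < (j :: int)}" and ?down = "{(i, j). j < (i :: int)}"
  have arcs: "(f v, v) \<in> S ?up \<or> (f v, v) \<in> S ?down" if "v \<in> ?T" for v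
  proof -
    have v: "v \<in> W" "v \<notin> R" "(v, f v) \<notin> (parent_arcs W b)\<^sup>+"
      using that unfolding transverse_def by auto
    have "v \<noteq> f v" "f v \<in> W" using v(1,2) forward[of v] by auto
    have not_prefix: "p (f v) \<noteq> p v @ zs" for zs
    proof
      assume "p (f v) = p v @ zs"
      then have "(v, f v) \<in> (parent_arcs W b)\<^sup>*"
        using ancestor_of_prefix[OF p \<open>f v \<in> W\<close> v(1)] by blast
      then show False using v(3) \<open>v \<noteq> f v\<close> by (simp add: rtrancl_eq_or_trancl)
    qed
    have "(p (f v), p v) \<in> lexord ?up \<or> p (f v) = p v \<or> (p v, p (f v)) \<in> lexord ?up"
      by (rule lexord_linear) auto
    \<comment> \<open>Reversing the siblings reverses a comparison decided at a first differing
      entry; a comparison decided by \<open>p v\<close> being a prefix is excluded by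
      transversality.\<close>
    moreover have "(p (f v), p v) \<in> lexord ?down" if "(p v, p (f v)) \<in> lexord ?up"
      using that not_prefix unfolding lexord_def by blast
    ultimately show ?thesis using not_prefix[of "[]"] unfolding S_def by auto
  qed
  have fT: "finite ?T" using finite_W unfolding transverse_def by auto
  have "card ?T \<le> card ({v \<in> ?T. (f v, v) \<in> S ?up} \<union> {v \<in> ?T. (f v, v) \<in> S ?down})"
    using arcs fT by (intro card_mono) auto
  also have "\<dots> \<le> card {v \<in> ?T. (f v, v) \<in> S ?up} + card {v \<in> ?T. (f v, v) \<in> S ?down}"
    by (rule card_Un_le)
  finally obtain less where less: "less = ?up \<or> less = ?down"
    and half: "card ?T \<le> 2 * card {v \<in> ?T. (f v, v) \<in> S less}"
    by (cases "card {v \<in> ?T. (f v, v) \<in> S ?up} \<le> card {v \<in> ?T. (f v, v) \<in> S ?down}") fastforce+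
  define L where "L = {v \<in> ?T. (f v, v) \<in> S less}"
  have "trans less" "irrefl less" using less by (auto simp: trans_def irrefl_def)
  then have S: "trans (S less)" "irrefl (S less)"
    unfolding S_def by (auto intro!: trans_inv_image lexord_transI simp: irrefl_def lexord_irreflexive)
  have LW: "L \<subseteq> W" and RL: "R \<subseteq> W - L" using R_sub unfolding L_def transverse_def by auto
  have bf: "b v \<in> insert r W \<and> f v \<in> insert r W \<and> b v \<noteq> f v" if "v \<in> L" for v
    using that forward[of v] backward[of v] unfolding L_def transverse_def by auto
  \<comment> \<open>The backward parent is the default, the forward one the alternative offered on
    \<open>L\<close>. Doubling this count, with \<open>half\<close>, gives the factors 4 and 6 of
    the claim.\<close>
  obtain q where q: "\<And>v. v \<in> W \<Longrightarrow> q v = b v \<or> v \<in> L \<and> q v = f v"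
    and count: "card L + 2 * card R \<le> 3 * card (insert r W - q ` W)"
    using ex_parents_many_leaves[where g = b and h = f, OF finite_W root LW RL on_R(2) bf] by blast
  have "q v \<in> insert r W \<and> (q v, v) \<in> A \<and> (q v, v) \<in> S less" if v: "v \<in> W" for v
  proof -
    have "f v \<in> insert r W" "b v \<in> insert r W"
      using on_R forward(1) backward(1) v by blast+
    \<comment> \<open>The root path of a parent is a proper prefix of that of its child, so backward
      arcs increase in either order.\<close>
    moreover have "(b v, v) \<in> S less" using p(2)[OF v] unfolding S_def
      by (simp add: lexord_append_rightI)
    ultimately show ?thesis using q[OF v] A[OF v] unfolding L_def by auto
  qed
  note B = outbranching_of_parents[OF finite_W root S this]
  show ?thesis
    using B count half unfolding L_def by (intro exI[of _ "{(q v, v) | v. v \<in> W}"]) auto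
qed

text \<open>If the simple arc (f v, v) is not transverse, then the child w of v on the path to f v in
  the backward tree differs from f v, and the backward arc (v, w) is transverse.\<close>
lemma transverse_of_simple:
  assumes v: "v \<in> W - R" and simple: "(v, f v) \<notin> A" and A: "\<And>w. w \<in> W \<Longrightarrow> (b w, w) \<in> A"
  shows "v \<in> transverse W R f b \<union> b ` transverse W R b f"
proof (cases "(v, f v) \<in> (parent_arcs W b)\<^sup>+")
  case False
  then show ?thesis using v unfolding transverse_def by auto
next
  case True
  then obtain w where w: "(v, w) \<in> parent_arcs W b" and wf: "(w, f v) \<in> (parent_arcs W b)\<^sup>*"
    by (meson tranclD)
  have bw: "b w = v" "w \<in> W" using w unfolding parent_arcs_def by auto
  then have wR: "w \<notin> R" using on_R v root by auto
  have "w \<noteq> f v" using A[OF bw(2)] bw simple by auto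
  have "\<sigma> (f v) \<le> \<sigma> w"
    using opposite_trees.forward_descendant[OF swap wf bw(2)] by auto
  \<comment> \<open>A forward path from \<open>w\<close> to \<open>v\<close> ends with the arc from
    \<open>f v\<close>. Then \<open>f v\<close> would lie below \<open>w\<close> in both trees,
    which forces equal numbers and hence \<open>w = f v\<close>.\<close>
  have "(w, v) \<notin> (parent_arcs W f)\<^sup>+"
  proof
    assume "(w, v) \<in> (parent_arcs W f)\<^sup>+"
    then have "(w, f v) \<in> (parent_arcs W f)\<^sup>*"
      by (cases rule: trancl.cases) (auto simp: parent_arcs_def dest: trancl_into_rtrancl)
    then have "\<sigma> w \<le> \<sigma> (f v)" using forward_descendant bw(2) by auto
    then have "w = f v" using \<open>\<sigma> (f v) \<le> \<sigma> w\<close> inj bw(2) forward(1)[OF v] by (auto dest: inj_onD)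
    then show False using \<open>w \<noteq> f v\<close> by simp
  qed
  then have "w \<in> transverse W R b f" using bw wR unfolding transverse_def by auto
  then show ?thesis using bw by auto
qed

end

section \<open>Counting nice vertices against leaves\<close>

theorem theorem2:
  fixes V :: "'a set" and A :: "('a \<times> 'a) set" and r :: 'a and l :: nat
  assumes "rooted_digraph V A r"
    and "two_connected V A r"
    and "card (nice_vertices V A) = l"
  shows "\<exists>B. outbranching V A r B \<and> real (card (leaves V B)) \<ge> real l / 24"
proof -
  define W where "W = V - {r}"
  define R where "R = {y. (r, y) \<in> A}"
  define E where "E = A \<inter> W \<times> W"
  have fV: "finite V" and AV: "A \<subseteq> V \<times> V" and noloop: "\<And>v. (v, v) \<notin> A" and rV: "r \<in> V"
    and in_r: "\<And>u. (u, r) \<notin> A" and cR: "card R \<ge> 2"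
    using assms(1) by (simp_all add: rooted_digraph_def digraph_def R_def)
  have V: "V = insert r W" using rV unfolding W_def by auto
  have fW: "finite W" and rW: "r \<notin> W" using fV unfolding W_def by auto
  have RW: "R \<subseteq> W" using AV in_r unfolding R_def W_def by auto
  have "R \<noteq> {}" using cR by auto
  \<comment> \<open>A single vertex is no cut, so a path from \<open>r\<close> avoids
    \<open>w\<close>; it enters \<open>R\<close> with its first arc and never returns to
    \<open>r\<close>.\<close>
  have conn: "v \<in> reach_from E R {w}" if w: "w \<in> W" and v: "v \<in> W" "v \<noteq> w" for v w
  proof -
    have "\<not> is_cut V A r {w}" using assms(2) unfolding two_connected_def by fastforce
    then have "v \<in> reach_avoiding A r {w}" using w v unfolding is_cut_def W_def by auto
    then have "(r, v) \<in> (A \<inter> ((- {w}) \<times> (- {w})))\<^sup>*" unfolding reach_avoiding_def by simp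
    then have "v = r \<or> v \<in> reach_from E R {w}"
    proof (induction rule: rtrancl_induct)
      case (step u v)
      show ?case
      proof (cases "u = r")
        case True
        then show ?thesis using step unfolding R_def by (auto intro: reach_from.base)
      next
        case False
        then have "(u, v) \<in> E" using step AV in_r unfolding E_def W_def by auto
        then show ?thesis using step False by (auto intro: reach_from.step)
      qed
    qed simp
    then show ?thesis using v rW by auto
  qed
  obtain \<sigma> :: "'a \<Rightarrow> int" where inj: "inj_on \<sigma> W"
    and \<sigma>: "\<And>v. v \<in> W - R \<Longrightarrow> \<exists>a b. (a, v) \<in> E \<and> (b, v) \<in> E \<and> \<sigma> a < \<sigma> v \<and> \<sigma> v < \<sigma> b"
    using ex_flanked_numbering[OF fW RW \<open>R \<noteq> {}\<close> _ conn] unfolding E_def by blast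

  let ?N = "nice_vertices V A"
  \<comment> \<open>The tail of a simple in-arc of a nice vertex outside \<open>R\<close> is not
    \<open>r\<close>, so it has a number and can replace \<open>a\<close> or \<open>b\<close>,
    whichever lies on its side of \<open>v\<close>.\<close>
  have "\<exists>a b. (a, v) \<in> E \<and> (b, v) \<in> E \<and> \<sigma> a < \<sigma> v \<and> \<sigma> v < \<sigma> b \<and>
      (v \<in> ?N \<longrightarrow> (v, a) \<notin> A \<or> (v, b) \<notin> A)" if v: "v \<in> W - R" for v
  proof -
    obtain a b where ab: "(a, v) \<in> E" "(b, v) \<in> E" "\<sigma> a < \<sigma> v" "\<sigma> v < \<sigma> b" using \<sigma>[OF v] by blast
    show ?thesis
    proof (cases "v \<in> ?N")
      case True
      then obtain u where u: "(u, v) \<in> A" "(v, u) \<notin> A"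
        unfolding nice_vertices_def simple_arc_def by auto
      then have uE: "(u, v) \<in> E" using v AV unfolding E_def R_def W_def by auto
      then have "\<sigma> u \<noteq> \<sigma> v" using inj u noloop unfolding E_def by (auto dest: inj_onD)
      then show ?thesis using ab u uE by (meson linorder_neqE)
    qed (use ab in blast)
  qed
  then obtain f0 b0 where fb: "\<And>v. v \<in> W - R \<Longrightarrow> (f0 v, v) \<in> E \<and> (b0 v, v) \<in> E \<and>
      \<sigma> (f0 v) < \<sigma> v \<and> \<sigma> v < \<sigma> (b0 v) \<and> (v \<in> ?N \<longrightarrow> (v, f0 v) \<notin> A \<or> (v, b0 v) \<notin> A)"
    by metis
  define f where "f v = (if v \<in> R then r else f0 v)" for v
  define b where "b v = (if v \<in> R then r else b0 v)" for v
  have A: "(f v, v) \<in> A \<and> (b v, v) \<in> A" if "v \<in> W" for v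
    using fb[of v] that unfolding f_def b_def R_def E_def by auto
  interpret fwd: opposite_trees W R r \<sigma> f b
    using fW rW RW inj fb by unfold_locales (auto simp: f_def b_def E_def)
  interpret bwd: opposite_trees W R r "\<lambda>v. - \<sigma> v" b f
    by (rule fwd.swap)

  let ?F = "transverse W R f b" and ?B = "transverse W R b f"
  have fin: "finite ?F" "finite ?B" using fW unfolding transverse_def by auto
  \<comment> \<open>Outside \<open>R\<close>, a nice vertex has a simple forward or a simple
    backward in-arc by the choice of \<open>f0\<close> and \<open>b0\<close>;
    \<open>transverse_of_simple\<close> applies directly or with the trees swapped.\<close>
  have "?N \<subseteq> R \<union> ((?F \<union> b ` ?B) \<union> (?B \<union> f ` ?F))"
  proof
    fix v assume v: "v \<in> ?N"
    then have vW: "v \<in> W" using in_r unfolding nice_vertices_def simple_arc_def W_def by auto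
    show "v \<in> R \<union> ((?F \<union> b ` ?B) \<union> (?B \<union> f ` ?F))"
    proof (cases "v \<in> R")
      case False
      then have "(v, f v) \<notin> A \<or> (v, b v) \<notin> A" using fb[of v] v vW unfolding f_def b_def by auto
      then show ?thesis
      proof
        assume "(v, f v) \<notin> A"
        then have "v \<in> ?F \<union> b ` ?B" using fwd.transverse_of_simple[of v A] vW False A by simp
        then show ?thesis by (rule UnI2[OF UnI1])
      next
        assume "(v, b v) \<notin> A"
        then have "v \<in> ?B \<union> f ` ?F" using bwd.transverse_of_simple[of v A] vW False A by simp
        then show ?thesis by (rule UnI2[OF UnI2])
      qed
    qed simp
  qed
  then have "l \<le> card (R \<union> ((?F \<union> b ` ?B) \<union> (?B \<union> f ` ?F)))"
    using fin finite_subset[OF RW fW] unfolding assms(3)[symmetric] by (intro card_mono) simp_all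
  also have "\<dots> \<le> card R + ((card ?F + card (b ` ?B)) + (card ?B + card (f ` ?F)))"
    by (intro order_trans[OF card_Un_le] add_mono order_refl)
  also have "\<dots> \<le> card R + ((card ?F + card ?B) + (card ?B + card ?F))"
    using fin by (intro add_mono card_image_le order_refl)
  finally have l: "l \<le> card R + 2 * (card ?F + card ?B)" by simp

  obtain B1 where B1: "outbranching V A r B1" "card ?F + 4 * card R \<le> 6 * card (leaves V B1)"
    using fwd.ex_outbranching_transverse[of A] A V by auto
  obtain B2 where B2: "outbranching V A r B2" "card ?B + 4 * card R \<le> 6 * card (leaves V B2)"
    using bwd.ex_outbranching_transverse[of A] A V by auto
  \<comment> \<open>The hypotheses add up to \<open>m + 15 * d \<le> 12 * (i + j)\<close>, so the
    larger of \<open>i\<close> and \<open>j\<close> suffices.\<close>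
  have "m \<le> 24 * i \<or> m \<le> 24 * j"
    if "m \<le> d + 2 * (x + y)" "x + 4 * d \<le> 6 * i" "y + 4 * d \<le> 6 * j" for m d x y i j :: nat
    using that by presburger
  from this[OF l B1(2) B2(2)]
  have "real (card (leaves V B1)) \<ge> real l / 24 \<or> real (card (leaves V B2)) \<ge> real l / 24"
    by linarith
  then show ?thesis using B1(1) B2(1) by blast
qed

end
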